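(* Let $M_1$ and $M_2$ be matroids on disjoint finite sets. The $\mathcal{G}$-invariant of the free product $M_1\mathbin{\Box}M_2$ can be calculated from the $\mathcal{G}$-invariants of $M_1$ and $M_2$; that is, if $M_1',M_2'$ are matroids on disjoint finite sets with $\mathcal{G}(M_1')=\mathcal{G}(M_1)$ and $\mathcal{G}(M_2')=\mathcal{G}(M_2)$, then $\mathcal{G}(M_1'\mathbin{\Box}M_2')=\mathcal{G}(M_1\mathbin{\Box}M_2)$.
   Context: An $(n,r)$-sequence is a $0,1$-sequence of length $n$ with exactly $r$ ones. $\mathcal{G}(n,r)$ is the vector space over a field of characteristic zero with basis the formal symbols $[\underline{r}]$, one for each $(n,r)$-sequence $\underline{r}$. For a rank-$r$ matroid $M$ with rank function $r(\cdot)$ on an $n$-element set $E$, and a permutation (linear ordering) $\pi$ of $E$, the rank sequence $\underline{r}(\pi)=r_1r_2\ldots r_n$ is given by $r_1=r(\{\pi(1)\})$ and $r_j=r(\{\pi(1),\ldots,\pi(j)\})-r(\{\pi(1),\ldots,\pi(j-1)\})$ for $j\ge2$. The $\mathcal{G}$-invariant is $\mathcal{G}(M)=\sum_{\pi}[\underline{r}(\pi)]\in\mathcal{G}(n,r)$, the sum over all $n!$ permutations of $E$. For matroids $M_1,M_2$ of ranks $r_1,r_2$ on disjoint sets $E_1,E_2$, the free product $M_1\mathbin{\Box}M_2$ is the matroid on $E_1\cup E_2$ whose bases are the subsets $B$ of $E_1\cup E_2$ of size $r_1+r_2$ such that $B\cap E_1$ is independent in $M_1$ and $B\cap E_2$ spans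 $M_2$. Its rank function is, for $X_i\subseteq E_i$, $r_{M_1\Box M_2}(X_1\cup X_2)=\min\{r_1(E_1)+r_2(X_2),\;r_1(X_1)+|X_2|\}$, where $r_i(\cdot)$ is the rank function of $M_i$. *)

theory Defs
  imports Complex_Main "HOL-Library.Poly_Mapping" "HOL-Combinatorics.Multiset_Permutations"
begin

record 'a set_system =
  ground :: "'a set"
  indep :: "'a set \<Rightarrow> bool"

locale matroid =
  fixes M :: "'a set_system"
  assumes finite_ground: "finite (ground M)"
    and indep_subset_ground: "indep M X \<Longrightarrow> X \<subseteq> ground M"
    and indep_empty: "indep M {}"
    and indep_subset: "indep M X \<Longrightarrow> Y \<subseteq> X \<Longrightarrow> indep M Y"
    and indep_augment:
      "indep M X \<Longrightarrow> indep M Y \<Longrightarrow> card X = Suc (card Y) \<Longrightarrow> \<exists>x\<in>X - Y. indep M (insert x Y)"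

definition rank_of :: "'a set_system \<Rightarrow> 'a set \<Rightarrow> nat" where
  "rank_of M X = Max {card I |I. I \<subseteq> X \<and> indep M I}"

abbreviation matroid_rank :: "'a set_system \<Rightarrow> nat" where
  "matroid_rank M \<equiv> rank_of M (ground M)"

definition spanning :: "'a set_system \<Rightarrow> 'a set \<Rightarrow> bool" where
  "spanning M X \<longleftrightarrow> X \<subseteq> ground M \<and> rank_of M X = matroid_rank M"

definition free_product_bases :: "'a set_system \<Rightarrow> 'a set_system \<Rightarrow> 'a set set" where
  "free_product_bases M1 M2 =
     {B. B \<subseteq> ground M1 \<union> ground M2 \<and> card B = matroid_rank M1 + matroid_rank M2 \<and>
         indep M1 (B \<inter> ground M1) \<and> spanning M2 (B \<inter> ground M2)}"

definition free_product :: "'a set_system \<Rightarrow> 'a set_system \<Rightarrow> 'a set_system"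
    (infixl \<open>\<box>\<close> 70) where
  "M1 \<box> M2 = \<lparr>ground = ground M1 \<union> ground M2,
               indep = (\<lambda>X. \<exists>B\<in>free_product_bases M1 M2. X \<subseteq> B)\<rparr>"

text \<open>
  A permutation of the ground set is a list in \<^const>\<open>permutations_of_set\<close>; positions are counted
  from 0, and the entry at position 0 is the rank of the first element because the empty set has
  rank 0. The truncated subtraction is harmless because the rank function is monotone.
\<close>

definition rank_sequence :: "'a set_system \<Rightarrow> 'a list \<Rightarrow> nat list" where
  "rank_sequence M p =
     map (\<lambda>j. rank_of M (set (take (Suc j) p)) - rank_of M (set (take j p))) [0..<length p]"

definition nr_sequences :: "nat \<Rightarrow> nat \<Rightarrow> nat list set" where
  "nr_sequences n r = {s. length s = n \<and> set s \<subseteq> {0, 1} \<and> count_list s 1 = r}"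

text \<open>
  All the spaces with basis the symbols of the $(n,r)$-sequences are realised inside the free vector
  space on all sequences; the symbol of a sequence \<open>s\<close> is \<open>Poly_Mapping.single s 1\<close>. The coefficients of
  a \<open>\<G>\<close>-invariant sum to $n! \neq 0$, so a \<open>\<G>\<close>-invariant lies in \<open>G_space n r\<close> for only one pair
  $(n,r)$, and equality of two \<open>\<G>\<close>-invariants includes equality of sizes and of ranks.
\<close>

definition G_space :: "nat \<Rightarrow> nat \<Rightarrow> (nat list \<Rightarrow>\<^sub>0 'k::field_char_0) set" where
  "G_space n r = {v. Poly_Mapping.keys v \<subseteq> nr_sequences n r}"

definition G_invariant :: "'a set_system \<Rightarrow> (nat list \<Rightarrow>\<^sub>0 'k::field_char_0)" where
  "G_invariant M =
     (\<Sum>p\<in>permutations_of_set (ground M). Poly_Mapping.single (rank_sequence M p) 1)"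


context matroid
begin

lemma finite_indep: "indep M I \<Longrightarrow> finite I"
  using finite_ground indep_subset_ground finite_subset by blast

lemma finite_rank_set: "finite {card I |I. I \<subseteq> X \<and> indep M I}"
proof -
  have "{card I |I. I \<subseteq> X \<and> indep M I} \<subseteq> card ` Pow (ground M)"
    using indep_subset_ground by auto
  then show ?thesis
    using finite_ground finite_subset by blast
qed

lemma card_le_rank: "I \<subseteq> X \<Longrightarrow> indep M I \<Longrightarrow> card I \<le> rank_of M X"
  unfolding rank_of_def using finite_rank_set by (intro Max_ge) auto

lemma rank_obtain:
  obtains I where "I \<subseteq> X" "indep M I" "card I = rank_of M X"
proof -
  have "rank_of M X \<in> {card I |I. I \<subseteq> X \<and> indep M I}"
    unfolding rank_of_def using finite_rank_set indep_empty by (intro Max_in) auto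
  then show ?thesis using that by auto
qed

lemma rank_leI: "(\<And>I. I \<subseteq> X \<Longrightarrow> indep M I \<Longrightarrow> card I \<le> k) \<Longrightarrow> rank_of M X \<le> k"
  by (metis rank_obtain)

lemma rank_empty: "rank_of M {} = 0"
  using rank_leI[of "{}" 0] by auto

lemma rank_mono: "X \<subseteq> Y \<Longrightarrow> rank_of M X \<le> rank_of M Y"
  by (metis rank_obtain card_le_rank subset_trans)

lemma rank_le_card: "finite X \<Longrightarrow> rank_of M X \<le> card X"
  by (metis rank_obtain card_mono)

lemma rank_indep: "indep M X \<Longrightarrow> rank_of M X = card X"
  by (meson card_le_rank finite_indep le_antisym rank_le_card subset_refl)

lemma augment_less:
  assumes "indep M X" "indep M Y" "card Y < card X"
  shows "\<exists>x\<in>X - Y. indep M (insert x Y)"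
proof -
  obtain X' where X': "X' \<subseteq> X" "card X' = Suc (card Y)"
    using assms(3) by (metis Suc_leI obtain_subset_with_card_n)
  then have "indep M X'" using assms(1) indep_subset by blast
  from indep_augment[OF this assms(2) X'(2)] show ?thesis using X' by blast
qed

lemma rank_Un_le:
  assumes "finite Z"
  shows "rank_of M (X \<union> Z) \<le> rank_of M X + card Z"
proof (rule rank_leI)
  fix I assume I: "I \<subseteq> X \<union> Z" "indep M I"
  have "card I \<le> card (I \<inter> X) + card (I \<inter> Z)"
    using I by (metis Int_Un_distrib card_Un_le inf.absorb1)
  moreover have "card (I \<inter> X) \<le> rank_of M X"
    using I indep_subset by (intro card_le_rank) auto
  moreover have "card (I \<inter> Z) \<le> card Z"
    using assms by (intro card_mono) auto
  ultimately show "card I \<le> rank_of M X + card Z" by linarith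
qed

lemma rank_diff_le:
  assumes "finite Y" "X \<subseteq> Y"
  shows "card X + rank_of M Y \<le> card Y + rank_of M X"
proof -
  have "rank_of M (X \<union> (Y - X)) \<le> rank_of M X + card (Y - X)"
    using assms by (intro rank_Un_le) auto
  moreover have "X \<union> (Y - X) = Y" using assms by auto
  moreover have "card Y = card X + card (Y - X)"
    using assms by (metis card_Diff_subset card_mono finite_subset le_add_diff_inverse)
  ultimately show ?thesis by simp
qed

lemma rank_less_obtain:
  assumes "rank_of M Y < rank_of M X"
  obtains x where "x \<in> X - Y" "x \<in> ground M" "rank_of M Y < rank_of M (insert x Y)"
proof -
  obtain I where I: "I \<subseteq> X" "indep M I" "card I = rank_of M X" by (rule rank_obtain)
  obtain J where J: "J \<subseteq> Y" "indep M J" "card J = rank_of M Y" by (rule rank_obtain)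
  obtain x where x: "x \<in> I - J" "indep M (insert x J)"
    using augment_less[OF I(2) J(2)] I(3) J(3) assms by auto
  have c: "card (insert x J) = Suc (rank_of M Y)"
    using x(1) J finite_indep by auto
  have "card (insert x J) \<le> rank_of M (insert x Y)"
    using x J by (intro card_le_rank) auto
  moreover have "x \<notin> Y"
  proof
    assume "x \<in> Y"
    then have "card (insert x J) \<le> rank_of M Y"
      using x J by (intro card_le_rank) auto
    then show False using c by simp
  qed
  moreover have "x \<in> ground M" using x(2) indep_subset_ground by blast
  ultimately show ?thesis using that[of x] c x I by auto
qed

lemma rank_sequence_in:
  assumes "p \<in> permutations_of_set (ground M)"
  shows "rank_sequence M p \<in> nr_sequences (card (ground M)) (matroid_rank M)"
proof -
  let ?d = "\<lambda>j. rank_of M (set (take (Suc j) p)) - rank_of M (set (take j p))"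
  have p: "set p = ground M" "distinct p" using assms by (auto simp: permutations_of_set_def)
  have len: "length (rank_sequence M p) = card (ground M)"
    unfolding rank_sequence_def using p distinct_card by fastforce
  have mono: "rank_of M (set (take j p)) \<le> rank_of M (set (take (Suc j) p))" for j
    by (intro rank_mono set_take_subset_set_take) simp
  have le1: "?d j \<le> 1" if "j < length p" for j
  proof -
    have "set (take (Suc j) p) = set (take j p) \<union> {p ! j}"
      using that by (simp add: take_Suc_conv_app_nth)
    then show ?thesis using rank_Un_le[of "{p ! j}" "set (take j p)"] by simp
  qed
  have s01: "set (rank_sequence M p) \<subseteq> {0, 1}"
  proof
    fix y assume "y \<in> set (rank_sequence M p)"
    then obtain j where "j < length p" "y = ?d j" by (auto simp: rank_sequence_def)
    then have "y \<le> 1" using le1 by simp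
    then show "y \<in> {0, 1}" by auto
  qed
  have "sum_list (map ?d [0..<k]) = rank_of M (set (take k p))" for k
  proof (induction k)
    case 0 then show ?case by (simp add: rank_empty)
  next
    case (Suc k) then show ?case using mono[of k] by simp
  qed
  from this[of "length p"] have "sum_list (rank_sequence M p) = matroid_rank M"
    unfolding rank_sequence_def using p by simp
  moreover have "set s \<subseteq> {0, 1} \<Longrightarrow> count_list s 1 = sum_list s" for s :: "nat list"
    by (induction s) auto
  ultimately show ?thesis using s01 len by (auto simp: nr_sequences_def)
qed

lemma G_invariant_in_G_space:
  "G_invariant M \<in> G_space (card (ground M)) (matroid_rank M)"
proof -
  have "Poly_Mapping.keys (\<Sum>p\<in>A. Poly_Mapping.single (rank_sequence M p) (1::'k::field_char_0))
      \<subseteq> rank_sequence M ` A" for A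
  proof (induction A rule: infinite_finite_induct)
    case (insert x F)
    then show ?case
      using keys_add[of "Poly_Mapping.single (rank_sequence M x) (1::'k)"
          "\<Sum>p\<in>F. Poly_Mapping.single (rank_sequence M p) 1"] by auto
  qed auto
  then show ?thesis
    unfolding G_space_def G_invariant_def using rank_sequence_in by blast
qed

end


locale matroid_pair = M1: matroid M1 + M2: matroid M2
  for M1 M2 :: "'a set_system" +
  assumes disjoint: "ground M1 \<inter> ground M2 = {}"
begin

lemma card_split:
  assumes "X \<subseteq> ground M1 \<union> ground M2"
  shows "card X = card (X \<inter> ground M1) + card (X \<inter> ground M2)"
proof -
  have "X = (X \<inter> ground M1) \<union> (X \<inter> ground M2)" using assms by auto
  then show ?thesis
    using card_Un_disjoint[of "X \<inter> ground M1" "X \<inter> ground M2"] disjoint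
      M1.finite_ground M2.finite_ground
    by (metis (no_types, lifting) Int_assoc Int_left_commute finite_Int inf_bot_right)
qed

definition fp_indep :: "'a set \<Rightarrow> bool" where
  "fp_indep X \<longleftrightarrow> X \<subseteq> ground M1 \<union> ground M2 \<and> indep M1 (X \<inter> ground M1) \<and>
     card X \<le> matroid_rank M1 + rank_of M2 (X \<inter> ground M2)"

lemma finite_fp: "X \<subseteq> ground M1 \<union> ground M2 \<Longrightarrow> finite X"
  using M1.finite_ground M2.finite_ground finite_subset by blast

lemma fp_indep_subset:
  assumes "fp_indep X" "Y \<subseteq> X"
  shows "fp_indep Y"
proof -
  have X: "X \<subseteq> ground M1 \<union> ground M2" "indep M1 (X \<inter> ground M1)"
    "card X \<le> matroid_rank M1 + rank_of M2 (X \<inter> ground M2)"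
    using assms(1) by (auto simp: fp_indep_def)
  have "card (Y \<inter> ground M2) + rank_of M2 (X \<inter> ground M2)
      \<le> card (X \<inter> ground M2) + rank_of M2 (Y \<inter> ground M2)"
    using assms(2) M2.finite_ground by (intro M2.rank_diff_le) auto
  moreover have "card (Y \<inter> ground M1) \<le> card (X \<inter> ground M1)"
    using assms(2) M1.finite_ground by (intro card_mono) auto
  moreover have "card Y = card (Y \<inter> ground M1) + card (Y \<inter> ground M2)"
    using X assms(2) by (intro card_split) auto
  moreover note card_split[OF X(1)] X(3)
  ultimately have "card Y \<le> matroid_rank M1 + rank_of M2 (Y \<inter> ground M2)"
    by linarith
  moreover have "indep M1 (Y \<inter> ground M1)"
    using X(2) assms(2) by (elim M1.indep_subset) auto
  ultimately show ?thesis using X(1) assms(2) by (auto simp: fp_indep_def)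
qed

lemma fp_indep_insert1:
  assumes "fp_indep Y" "x \<in> ground M1" "indep M1 (insert x (Y \<inter> ground M1))"
    "card Y < matroid_rank M1 + rank_of M2 (Y \<inter> ground M2)"
  shows "fp_indep (insert x Y)"
proof -
  have "insert x Y \<inter> ground M2 = Y \<inter> ground M2" using assms(2) disjoint by auto
  moreover have "insert x Y \<inter> ground M1 = insert x (Y \<inter> ground M1)" using assms(2) by auto
  moreover have "card (insert x Y) \<le> Suc (card Y)" by (rule card_insert_le_m1) simp_all
  ultimately show ?thesis using assms unfolding fp_indep_def by auto
qed

lemma fp_indep_insert2:
  assumes "fp_indep Y" "x \<in> ground M2"
    "card Y < matroid_rank M1 + rank_of M2 (insert x (Y \<inter> ground M2))"
  shows "fp_indep (insert x Y)"
proof -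
  have "insert x Y \<inter> ground M1 = Y \<inter> ground M1" using assms(2) disjoint by auto
  moreover have "insert x Y \<inter> ground M2 = insert x (Y \<inter> ground M2)" using assms(2) by auto
  moreover have "card (insert x Y) \<le> Suc (card Y)" by (rule card_insert_le_m1) simp_all
  ultimately show ?thesis using assms unfolding fp_indep_def by auto
qed

lemma fp_indep_augment:
  assumes X: "fp_indep X" and Y: "fp_indep Y" and less: "card Y < card X"
  shows "\<exists>x\<in>X - Y. fp_indep (insert x Y)"
proof (cases "card Y < matroid_rank M1 + rank_of M2 (Y \<inter> ground M2)")
  case False
  then have "rank_of M2 (Y \<inter> ground M2) < rank_of M2 (X \<inter> ground M2)"
    using X less by (auto simp: fp_indep_def)
  then obtain x where x: "x \<in> X \<inter> ground M2 - Y \<inter> ground M2"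
    "rank_of M2 (Y \<inter> ground M2) < rank_of M2 (insert x (Y \<inter> ground M2))"
    by (rule M2.rank_less_obtain)
  moreover have "card Y \<le> matroid_rank M1 + rank_of M2 (Y \<inter> ground M2)"
    using Y by (auto simp: fp_indep_def)
  ultimately show ?thesis using fp_indep_insert2[OF Y, of x] by auto
next
  case True
  show ?thesis
  proof (cases "X \<inter> ground M2 \<subseteq> Y")
    case False
    then obtain x where x: "x \<in> X" "x \<in> ground M2" "x \<notin> Y" by auto
    have "rank_of M2 (Y \<inter> ground M2) \<le> rank_of M2 (insert x (Y \<inter> ground M2))"
      by (intro M2.rank_mono) auto
    then show ?thesis using fp_indep_insert2[OF Y x(2)] True x by auto
  next
    case sub: True
    have "card (X \<inter> ground M2) \<le> card (Y \<inter> ground M2)"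
      using sub M2.finite_ground by (intro card_mono) auto
    then have "card (Y \<inter> ground M1) < card (X \<inter> ground M1)"
      using less card_split[of X] card_split[of Y] X Y by (auto simp: fp_indep_def)
    then obtain x where x: "x \<in> X \<inter> ground M1 - Y \<inter> ground M1" "indep M1 (insert x (Y \<inter> ground M1))"
      using M1.augment_less[of "X \<inter> ground M1" "Y \<inter> ground M1"] X Y by (auto simp: fp_indep_def)
    then show ?thesis using fp_indep_insert1[OF Y _ x(2) True] by auto
  qed
qed

lemma fp_indep_basis:
  "fp_indep B \<Longrightarrow> card B = matroid_rank M1 + matroid_rank M2 \<Longrightarrow> B \<in> free_product_bases M1 M2"
  unfolding fp_indep_def free_product_bases_def spanning_def
  using M2.rank_mono[of "B \<inter> ground M2" "ground M2"] by auto

lemma basis_fp_indep: "B \<in> free_product_bases M1 M2 \<Longrightarrow> fp_indep B"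
  unfolding fp_indep_def free_product_bases_def spanning_def by auto

lemma ex_free_product_basis: "free_product_bases M1 M2 \<noteq> {}"
proof -
  obtain I where I: "I \<subseteq> ground M1" "indep M1 I" "card I = matroid_rank M1"
    by (rule M1.rank_obtain)
  obtain J where J: "J \<subseteq> ground M2" "indep M2 J" "card J = matroid_rank M2"
    by (rule M2.rank_obtain)
  have e: "(I \<union> J) \<inter> ground M1 = I" "(I \<union> J) \<inter> ground M2 = J" using I J disjoint by auto
  have "card (I \<union> J) = card I + card J" using card_split[of "I \<union> J"] e I J by auto
  then have "I \<union> J \<in> free_product_bases M1 M2"
    using e I J M2.rank_indep[OF J(2)] by (auto simp: free_product_bases_def spanning_def)
  then show ?thesis by blast
qed

lemma fp_indep_extend:
  assumes "fp_indep X"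
  shows "\<exists>B\<in>free_product_bases M1 M2. X \<subseteq> B"
proof -
  obtain B0 where B0: "B0 \<in> free_product_bases M1 M2" using ex_free_product_basis by blast
  have cB0: "card B0 = matroid_rank M1 + matroid_rank M2"
    using B0 by (simp add: free_product_bases_def)
  show ?thesis using assms
  proof (induction "card B0 - card X" arbitrary: X rule: less_induct)
    case less
    have "card X \<le> card B0"
      using less.prems M2.rank_mono[of "X \<inter> ground M2" "ground M2"] cB0
      by (auto simp: fp_indep_def)
    then consider "card X = card B0" | "card X < card B0" by linarith
    then show ?case
    proof cases
      case 1
      then show ?thesis using fp_indep_basis less.prems cB0 by auto
    next
      case 2
      obtain x where x: "x \<in> B0 - X" "fp_indep (insert x X)"
        using fp_indep_augment[OF basis_fp_indep[OF B0] less.prems 2] by auto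
      have "finite X" using less.prems finite_fp by (auto simp: fp_indep_def)
      then have "card B0 - card (insert x X) < card B0 - card X" using x 2 by auto
      from less.hyps[OF this x(2)] show ?thesis by auto
    qed
  qed
qed

lemma indep_free_product: "indep (M1 \<box> M2) X \<longleftrightarrow> fp_indep X"
  unfolding free_product_def
  by (simp, blast intro: fp_indep_extend fp_indep_subset[OF basis_fp_indep])

lemma matroid_free_product: "matroid (M1 \<box> M2)"
proof
  show "finite (ground (M1 \<box> M2))"
    using M1.finite_ground M2.finite_ground by (simp add: free_product_def)
  show "X \<subseteq> ground (M1 \<box> M2)" if "indep (M1 \<box> M2) X" for X
    using that unfolding indep_free_product fp_indep_def by (simp add: free_product_def)
  show "indep (M1 \<box> M2) {}"
    using M1.indep_empty by (simp add: indep_free_product fp_indep_def)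
  show "indep (M1 \<box> M2) Y" if "indep (M1 \<box> M2) X" "Y \<subseteq> X" for X Y
    using that fp_indep_subset by (simp add: indep_free_product)
  show "\<exists>x\<in>X - Y. indep (M1 \<box> M2) (insert x Y)"
    if "indep (M1 \<box> M2) X" "indep (M1 \<box> M2) Y" "card X = Suc (card Y)" for X Y
    using that fp_indep_augment by (simp add: indep_free_product)
qed

lemma rank_free_product:
  assumes X1: "X1 \<subseteq> ground M1" and X2: "X2 \<subseteq> ground M2"
  shows "rank_of (M1 \<box> M2) (X1 \<union> X2) =
    min (matroid_rank M1 + rank_of M2 X2) (rank_of M1 X1 + card X2)" (is "_ = ?m")
proof (rule antisym)
  interpret P: matroid "M1 \<box> M2" by (rule matroid_free_product)
  show "rank_of (M1 \<box> M2) (X1 \<union> X2) \<le> ?m"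
  proof (rule P.rank_leI)
    fix I assume I: "I \<subseteq> X1 \<union> X2" "indep (M1 \<box> M2) I"
    have f: "fp_indep I" using I by (simp add: indep_free_product)
    have s: "I \<inter> ground M1 \<subseteq> X1" "I \<inter> ground M2 \<subseteq> X2"
      using I(1) X1 X2 disjoint by auto
    have "card I = card (I \<inter> ground M1) + card (I \<inter> ground M2)"
      using f by (intro card_split) (auto simp: fp_indep_def)
    moreover have "card (I \<inter> ground M1) \<le> rank_of M1 X1"
      using s f by (intro M1.card_le_rank) (auto simp: fp_indep_def)
    moreover have "card (I \<inter> ground M2) \<le> card X2"
      using s X2 M2.finite_ground finite_subset by (intro card_mono) auto
    moreover have "card I \<le> matroid_rank M1 + rank_of M2 X2"
      using f M2.rank_mono[OF s(2)] by (auto simp: fp_indep_def)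
    ultimately show "card I \<le> ?m" by auto
  qed
  obtain I where I: "I \<subseteq> X1" "indep M1 I" "card I = rank_of M1 X1" by (rule M1.rank_obtain)
  obtain J where J: "J \<subseteq> X2" "indep M2 J" "card J = rank_of M2 X2" by (rule M2.rank_obtain)
  have finX2: "finite X2" using X2 M2.finite_ground finite_subset by blast
  have r1: "rank_of M1 X1 \<le> matroid_rank M1" using M1.rank_mono[OF X1] .
  have r2: "rank_of M2 X2 \<le> card X2" using M2.rank_le_card[OF finX2] .
  have "card (X2 - J) = card X2 - card J"
    using J finX2 by (meson card_Diff_subset finite_subset)
  then have "?m - (rank_of M1 X1 + rank_of M2 X2) \<le> card (X2 - J)"
    using J(3) r2 by linarith
  then obtain K where K: "K \<subseteq> X2 - J" "card K = ?m - (rank_of M1 X1 + rank_of M2 X2)"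
    by (rule obtain_subset_with_card_n)
  let ?S = "I \<union> (J \<union> K)"
  have e: "?S \<inter> ground M1 = I" "?S \<inter> ground M2 = J \<union> K"
    using I J K X1 X2 disjoint by auto
  have sub: "?S \<subseteq> ground M1 \<union> ground M2" using I J K X1 X2 by auto
  have "card (J \<union> K) = card J + card K"
    using J K finX2 by (intro card_Un_disjoint) (auto intro: finite_subset)
  then have c: "card ?S = ?m"
    using card_split[OF sub] e I(3) J(3) K(2) r1 r2 by auto
  have "rank_of M2 X2 \<le> rank_of M2 (J \<union> K)"
    using M2.card_le_rank[of J "J \<union> K"] J by auto
  then have "fp_indep ?S" using e sub c I(2) by (auto simp: fp_indep_def)
  then show "?m \<le> rank_of (M1 \<box> M2) (X1 \<union> X2)"
    using P.card_le_rank[of ?S "X1 \<union> X2"] c I J K by (auto simp: indep_free_product)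
qed

end

end

theory Submission
  imports Defs
begin

text \<open>
  An ordering of \<open>E\<^sub>1 \<union> E\<^sub>2\<close> amounts to an ordering of \<open>E\<^sub>1\<close>, an ordering of \<open>E\<^sub>2\<close> and a shuffle
  pattern, that is, a word recording which positions hold elements of \<open>E\<^sub>1\<close>. By the formula for the
  rank function of the free product, the rank sequence of the shuffled ordering depends only on the
  pattern and on the rank sequences of the two parts. Hence the invariant of the free product is a
  bilinear expression in the multisets of rank sequences of the factors, and in characteristic zero
  these multisets are determined by the invariants.
\<close>

text \<open>The recursion runs on the word alone. On a word in
  \<open>shuffle_patterns (length xs) (length ys)\<close>, \<open>hd\<close> and \<open>tl\<close>
  never meet an empty list, so their unspecified values do not matter.\<close>

fun merge_by :: "bool list \<Rightarrow> 'a list \<Rightarrow> 'a list \<Rightarrow> 'a list" where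
  "merge_by [] xs ys = []"
| "merge_by (True # w) xs ys = hd xs # merge_by w (tl xs) ys"
| "merge_by (False # w) xs ys = hd ys # merge_by w xs (tl ys)"

definition shuffle_patterns :: "nat \<Rightarrow> nat \<Rightarrow> bool list set" where
  "shuffle_patterns m n = {w. count_list w True = m \<and> count_list w False = n}"

lemma merge_by_filter: "merge_by (map Q p) (filter Q p) (filter (\<lambda>x. \<not> Q x) p) = p"
proof (induction p)
  case (Cons x p)
  then show ?case by (cases "Q x") auto
qed simp

text \<open>The converse of \<open>merge_by_filter\<close>: \<open>Q\<close> tells from which list
  an entry came, and the letter counts guarantee that both lists are used up exactly.\<close>

lemma merge_by_inverse:
  assumes "w \<in> shuffle_patterns (length xs) (length ys)" "\<forall>x\<in>set xs. Q x" "\<forall>y\<in>set ys. \<not> Q y"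
  shows "map Q (merge_by w xs ys) = w" "filter Q (merge_by w xs ys) = xs"
    "filter (\<lambda>x. \<not> Q x) (merge_by w xs ys) = ys"
proof -
  have "map Q (merge_by w xs ys) = w \<and> filter Q (merge_by w xs ys) = xs \<and>
    filter (\<lambda>x. \<not> Q x) (merge_by w xs ys) = ys"
    using assms
  proof (induction w xs ys rule: merge_by.induct)
    case (2 w xs ys)
    then show ?case by (cases xs) (auto simp: shuffle_patterns_def)
  next
    case (3 w xs ys)
    then show ?case by (cases ys) (auto simp: shuffle_patterns_def)
  qed (auto simp: shuffle_patterns_def)
  then show "map Q (merge_by w xs ys) = w" "filter Q (merge_by w xs ys) = xs"
    "filter (\<lambda>x. \<not> Q x) (merge_by w xs ys) = ys" by auto
qed

lemma count_list_map_pred: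
  "count_list (map Q p) True = length (filter Q p)"
  "count_list (map Q p) False = length (filter (\<lambda>x. \<not> Q x) p)"
  by (induction p) auto

text \<open>Lets the part of a prefix of \<open>p\<close> lying in one factor be treated as a prefix
  of the ordering of that factor.\<close>

lemma filter_take: "filter Q (take j p) = take (length (filter Q (take j p))) (filter Q p)"
  by (metis append_eq_conv_conj append_take_drop_id filter_append)

text \<open>Reindexing along the bijection that splits \<open>p\<close> into its two filtered lists
  and its membership word, with inverse \<open>merge_by\<close>.\<close>

lemma sum_permutations_of_Un:
  assumes "A \<inter> B = {}"
  shows "(\<Sum>p\<in>permutations_of_set (A \<union> B).
            f (map (\<lambda>x. x \<in> A) p) (filter (\<lambda>x. x \<in> A) p) (filter (\<lambda>x. x \<notin> A) p)) =
    (\<Sum>p1\<in>permutations_of_set A. \<Sum>p2\<in>permutations_of_set B.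
       \<Sum>w\<in>shuffle_patterns (length p1) (length p2). f w p1 p2)"
proof -
  have finW: "finite (shuffle_patterns m n)" for m n
  proof -
    have "length w = count_list w True + count_list w False" for w
      by (induction w) auto
    then have "shuffle_patterns m n \<subseteq> {w. set w \<subseteq> UNIV \<and> length w = m + n}"
      by (auto simp: shuffle_patterns_def)
    then show ?thesis using finite_lists_length_eq finite_subset finite_UNIV by metis
  qed
  have "(\<Sum>p\<in>permutations_of_set (A \<union> B).
            f (map (\<lambda>x. x \<in> A) p) (filter (\<lambda>x. x \<in> A) p) (filter (\<lambda>x. x \<notin> A) p)) =
    (\<Sum>((p1, p2), w)\<in>(SIGMA q:permutations_of_set A \<times> permutations_of_set B.
       shuffle_patterns (length (fst q)) (length (snd q))). f w p1 p2)"
  proof (rule sum.reindex_bij_witness[where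
        j = "\<lambda>p. ((filter (\<lambda>x. x \<in> A) p, filter (\<lambda>x. x \<notin> A) p), map (\<lambda>x. x \<in> A) p)" and
        i = "\<lambda>b. merge_by (snd b) (fst (fst b)) (snd (fst b))"])
    fix p assume "p \<in> permutations_of_set (A \<union> B)"
    then show "((filter (\<lambda>x. x \<in> A) p, filter (\<lambda>x. x \<notin> A) p), map (\<lambda>x. x \<in> A) p)
      \<in> (SIGMA q:permutations_of_set A \<times> permutations_of_set B.
           shuffle_patterns (length (fst q)) (length (snd q)))"
      using assms by (auto simp: permutations_of_set_def shuffle_patterns_def count_list_map_pred)
  next
    fix b assume "b \<in> (SIGMA q:permutations_of_set A \<times> permutations_of_set B.
           shuffle_patterns (length (fst q)) (length (snd q)))"
    then obtain p1 p2 w where b: "b = ((p1, p2), w)"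
      and p: "set p1 = A" "distinct p1" "set p2 = B" "distinct p2"
      and w: "w \<in> shuffle_patterns (length p1) (length p2)"
      by (auto simp: permutations_of_set_def)
    let ?m = "merge_by w p1 p2"
    have inv: "map (\<lambda>x. x \<in> A) ?m = w" "filter (\<lambda>x. x \<in> A) ?m = p1" "filter (\<lambda>x. x \<notin> A) ?m = p2"
      using merge_by_inverse[OF w, of "\<lambda>x. x \<in> A"] p assms by auto
    then show "((filter (\<lambda>x. x \<in> A) (merge_by (snd b) (fst (fst b)) (snd (fst b))),
        filter (\<lambda>x. x \<notin> A) (merge_by (snd b) (fst (fst b)) (snd (fst b)))),
        map (\<lambda>x. x \<in> A) (merge_by (snd b) (fst (fst b)) (snd (fst b)))) = b"
      using b by simp
    \<comment> \<open>Both the underlying set and the distinctness of the merged list can be read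
      off its multiset.\<close>
    have mm: "mset ?m = mset p1 + mset p2"
      using inv by (metis multiset_partition mset_filter)
    then have "set ?m = A \<union> B"
      using p by (metis set_mset_mset set_mset_union)
    moreover have "distinct ?m"
    proof -
      have "distinct (p1 @ p2)" using p assms by auto
      then show ?thesis using mm by (metis mset_append mset_eq_imp_distinct_iff)
    qed
    ultimately show "merge_by (snd b) (fst (fst b)) (snd (fst b)) \<in> permutations_of_set (A \<union> B)"
      using b by (auto simp: permutations_of_set_def)
  qed (auto simp: merge_by_filter)
  also have "\<dots> = (\<Sum>q\<in>permutations_of_set A \<times> permutations_of_set B.
       \<Sum>w\<in>shuffle_patterns (length (fst q)) (length (snd q)). f w (fst q) (snd q))"
    by (subst sum.Sigma) (auto simp: finW case_prod_unfold)
  also have "\<dots> = (\<Sum>p1\<in>permutations_of_set A. \<Sum>p2\<in>permutations_of_set B.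
       \<Sum>w\<in>shuffle_patterns (length p1) (length p2). f w p1 p2)"
    by (subst sum.cartesian_product) (auto simp: case_prod_unfold)
  finally show ?thesis .
qed

text \<open>The rank formula of the free product for the elements at the positions of the prefix
  \<open>u\<close>: \<open>sum_list s1\<close> stands for the rank of M1, the partial sums for the
  ranks of X1 and X2, and the number of \<open>False\<close> letters for the size of X2.\<close>

definition merged_rank :: "bool list \<Rightarrow> nat list \<Rightarrow> nat list \<Rightarrow> nat" where
  "merged_rank u s1 s2 =
     min (sum_list s1 + sum_list (take (count_list u False) s2))
         (sum_list (take (count_list u True) s1) + count_list u False)"

definition merged_rank_sequence :: "bool list \<Rightarrow> nat list \<Rightarrow> nat list \<Rightarrow> nat list" where
  "merged_rank_sequence w s1 s2 =
     map (\<lambda>j. merged_rank (take (Suc j) w) s1 s2 - merged_rank (take j w) s1 s2) [0..<length w]"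

lemma length_rank_sequence: "length (rank_sequence M p) = length p"
  by (simp add: rank_sequence_def)

lemma (in matroid) sum_list_take_rank_sequence:
  "sum_list (take k (rank_sequence M p)) = rank_of M (set (take k p))"
proof -
  let ?d = "\<lambda>j. rank_of M (set (take (Suc j) p)) - rank_of M (set (take j p))"
  have sum: "sum_list (map ?d [0..<k]) = rank_of M (set (take k p))" for k
  proof (induction k)
    case (Suc k)
    have "rank_of M (set (take k p)) \<le> rank_of M (set (take (Suc k) p))"
      by (intro rank_mono set_take_subset_set_take) simp
    then show ?case using Suc by simp
  qed (simp add: rank_empty)
  \<comment> \<open>Beyond \<open>length p\<close> both occurrences of \<open>take\<close> return
    the whole list, so the telescoped sum at \<open>min k (length p)\<close> covers every
    \<open>k\<close>.\<close>
  show ?thesis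
    using sum[of "min k (length p)"]
    by (cases "k \<le> length p") (auto simp: rank_sequence_def take_map min_def)
qed

context matroid_pair
begin

text \<open>A prefix of \<open>p\<close> meets each factor in a prefix of that factor's ordering,
  whose length is a letter count of the pattern. Every quantity in the rank formula is thus known
  from the pattern and the two rank sequences.\<close>

lemma rank_sequence_free_product:
  assumes p: "p \<in> permutations_of_set (ground M1 \<union> ground M2)"
  shows "rank_sequence (M1 \<box> M2) p =
    merged_rank_sequence (map (\<lambda>x. x \<in> ground M1) p)
      (rank_sequence M1 (filter (\<lambda>x. x \<in> ground M1) p))
      (rank_sequence M2 (filter (\<lambda>x. x \<notin> ground M1) p))"
proof -
  let ?Q = "\<lambda>x. x \<in> ground M1"
  let ?p1 = "filter ?Q p" and ?p2 = "filter (\<lambda>x. \<not> ?Q x) p"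
  have setp: "set p = ground M1 \<union> ground M2" and dp: "distinct p"
    using p by (auto simp: permutations_of_set_def)
  have "rank_of (M1 \<box> M2) (set (take j p)) =
    merged_rank (take j (map ?Q p)) (rank_sequence M1 ?p1) (rank_sequence M2 ?p2)" for j
  proof -
    let ?q1 = "filter ?Q (take j p)" and ?q2 = "filter (\<lambda>x. \<not> ?Q x) (take j p)"
    have q1: "take (length ?q1) ?p1 = ?q1" and q2: "take (length ?q2) ?p2 = ?q2"
      using filter_take by metis+
    have "rank_of (M1 \<box> M2) (set ?q1 \<union> set ?q2) =
      min (matroid_rank M1 + rank_of M2 (set ?q2)) (rank_of M1 (set ?q1) + card (set ?q2))"
      using setp by (intro rank_free_product) (auto dest: in_set_takeD)
    moreover have "set ?q1 \<union> set ?q2 = set (take j p)" by auto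
    \<comment> \<open>The rank formula counts elements whereas the pattern counts positions; these
      agree because \<open>p\<close> is distinct.\<close>
    moreover have "card (set ?q2) = length ?q2" using dp by (intro distinct_card) simp
    moreover have "sum_list (rank_sequence M1 ?p1) = matroid_rank M1"
    proof -
      have "set ?p1 = ground M1" using setp by auto
      then show ?thesis
        using M1.sum_list_take_rank_sequence[of "length ?p1" ?p1] by (simp add: length_rank_sequence)
    qed
    ultimately show ?thesis
      by (simp add: merged_rank_def take_map count_list_map_pred
          M1.sum_list_take_rank_sequence M2.sum_list_take_rank_sequence q1 q2)
  qed
  then show ?thesis
    by (simp add: rank_sequence_def[of "M1 \<box> M2"] merged_rank_sequence_def)
qed

text \<open>The range of \<open>w\<close> is given by the lengths of the rank sequences, so that the
  innermost sum depends on the orderings only through their rank sequences.\<close>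

lemma G_invariant_free_product:
  "G_invariant (M1 \<box> M2) =
    (\<Sum>p1\<in>permutations_of_set (ground M1). \<Sum>p2\<in>permutations_of_set (ground M2).
       \<Sum>w\<in>shuffle_patterns (length (rank_sequence M1 p1)) (length (rank_sequence M2 p2)).
         Poly_Mapping.single
           (merged_rank_sequence w (rank_sequence M1 p1) (rank_sequence M2 p2)) 1)"
proof -
  have "G_invariant (M1 \<box> M2) = (\<Sum>p\<in>permutations_of_set (ground M1 \<union> ground M2).
      Poly_Mapping.single (merged_rank_sequence (map (\<lambda>x. x \<in> ground M1) p)
      (rank_sequence M1 (filter (\<lambda>x. x \<in> ground M1) p))
      (rank_sequence M2 (filter (\<lambda>x. x \<notin> ground M1) p))) 1)"
    unfolding G_invariant_def
    by (rule sum.cong) (auto simp: free_product_def rank_sequence_free_product[symmetric])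
  also have "\<dots> = (\<Sum>p1\<in>permutations_of_set (ground M1). \<Sum>p2\<in>permutations_of_set (ground M2).
       \<Sum>w\<in>shuffle_patterns (length p1) (length p2). Poly_Mapping.single
           (merged_rank_sequence w (rank_sequence M1 p1) (rank_sequence M2 p2)) 1)"
    by (rule sum_permutations_of_Un[OF disjoint])
  finally show ?thesis by (simp add: length_rank_sequence)
qed

end

lemma lookup_G_invariant:
  "Poly_Mapping.lookup (G_invariant M :: nat list \<Rightarrow>\<^sub>0 'k::field_char_0) s =
     of_nat (count (image_mset (rank_sequence M) (mset_set (permutations_of_set (ground M)))) s)"
proof -
  have "Poly_Mapping.lookup (\<Sum>p\<in>A. Poly_Mapping.single (rank_sequence M p) (1::'k)) s =
      of_nat (count (image_mset (rank_sequence M) (mset_set A)) s)" for A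
    by (induction A rule: infinite_finite_induct) (auto simp: lookup_add lookup_single when_def)
  then show ?thesis by (simp add: G_invariant_def)
qed

text \<open>Such a sum depends only on the multiset of rank sequences. Its multiplicities are
  recovered from the coefficients because \<open>of_nat\<close> is injective in characteristic
  zero.\<close>

lemma sum_rank_sequence_cong:
  fixes g :: "nat list \<Rightarrow> 'c::comm_monoid_add"
  assumes "(G_invariant M' :: nat list \<Rightarrow>\<^sub>0 'k::field_char_0) = G_invariant M"
  shows "(\<Sum>p\<in>permutations_of_set (ground M'). g (rank_sequence M' p)) =
    (\<Sum>p\<in>permutations_of_set (ground M). g (rank_sequence M p))"
proof -
  have "image_mset (rank_sequence M') (mset_set (permutations_of_set (ground M'))) =
    image_mset (rank_sequence M) (mset_set (permutations_of_set (ground M)))"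
    by (rule multiset_eqI) (metis assms lookup_G_invariant of_nat_eq_iff)
  then have "\<Sum>\<^sub># (image_mset g (image_mset (rank_sequence M')
      (mset_set (permutations_of_set (ground M'))))) =
    \<Sum>\<^sub># (image_mset g (image_mset (rank_sequence M) (mset_set (permutations_of_set (ground M)))))"
    by simp
  then show ?thesis by (simp add: sum_unfold_sum_mset image_mset.compositionality comp_def)
qed

theorem proposition4p11:
  fixes M1 M2 :: "'a set_system" and M1' M2' :: "'b set_system"
  assumes "matroid M1" and "matroid M2" and "ground M1 \<inter> ground M2 = {}"
    and "matroid M1'" and "matroid M2'" and "ground M1' \<inter> ground M2' = {}"
    and "(G_invariant M1' :: nat list \<Rightarrow>\<^sub>0 'k::field_char_0) = G_invariant M1"
    and "(G_invariant M2' :: nat list \<Rightarrow>\<^sub>0 'k) = G_invariant M2"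
  shows "(G_invariant (M1' \<box> M2') :: nat list \<Rightarrow>\<^sub>0 'k) = G_invariant (M1 \<box> M2)"
proof -
  have pair: "matroid_pair M1 M2" "matroid_pair M1' M2'"
    using assms by (auto simp: matroid_pair_def matroid_pair_axioms_def)
  \<comment> \<open>The contribution of one pair of rank sequences, summed over all
    shuffles.\<close>
  define H :: "nat list \<Rightarrow> nat list \<Rightarrow> nat list \<Rightarrow>\<^sub>0 'k" where
    "H s1 s2 = (\<Sum>w\<in>shuffle_patterns (length s1) (length s2).
       Poly_Mapping.single (merged_rank_sequence w s1 s2) 1)" for s1 s2
  have "G_invariant (M1' \<box> M2') =
    (\<Sum>p1\<in>permutations_of_set (ground M1'). \<Sum>p2\<in>permutations_of_set (ground M2').
       H (rank_sequence M1' p1) (rank_sequence M2' p2))"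
    unfolding H_def by (rule matroid_pair.G_invariant_free_product[OF pair(2)])
  also have "\<dots> = (\<Sum>p1\<in>permutations_of_set (ground M1'). \<Sum>p2\<in>permutations_of_set (ground M2).
       H (rank_sequence M1' p1) (rank_sequence M2 p2))"
    by (intro sum.cong refl sum_rank_sequence_cong[OF assms(8)])
  \<comment> \<open>Here the congruence is applied to the whole inner sum over \<open>p2\<close>, as
    a function of the first rank sequence.\<close>
  also have "\<dots> = (\<Sum>p1\<in>permutations_of_set (ground M1). \<Sum>p2\<in>permutations_of_set (ground M2).
       H (rank_sequence M1 p1) (rank_sequence M2 p2))"
    by (rule sum_rank_sequence_cong[OF assms(7)])
  also have "\<dots> = G_invariant (M1 \<box> M2)"
    unfolding H_def by (rule matroid_pair.G_invariant_free_product[OF pair(1), symmetric])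
  finally show ?thesis .
qed

end
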